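(* No axiomatic extension of $\mathbf{LV}$ by a set of axioms from $\{\mathbf W,\mathbf C,\mathbf N,\mathbf T,\mathbf S,\mathbf U,\mathbf A\}$ is algebraizable, except $\mathbf{LVCA}$.
   Context: $\mathbf{LV}$ is the smallest finitary consequence relation in the language $\{\land,\lor,\to,\mathbin{\Box\!\!\rightarrow},0,1\}$ containing classical axioms and (L1) $\varphi\mathbin{\Box\!\!\rightarrow}\varphi$, (L2) $((\varphi\mathbin{\Box\!\!\rightarrow}\psi)\wedge(\psi\mathbin{\Box\!\!\rightarrow}\varphi))\to((\varphi\mathbin{\Box\!\!\rightarrow}\gamma)\leftrightarrow(\psi\mathbin{\Box\!\!\rightarrow}\gamma))$, (L3) $((\varphi\vee\psi)\mathbin{\Box\!\!\rightarrow}\varphi)\vee((\varphi\vee\psi)\mathbin{\Box\!\!\rightarrow}\psi)\vee(((\varphi\vee\psi)\mathbin{\Box\!\!\rightarrow}\gamma)\leftrightarrow((\varphi\mathbin{\Box\!\!\rightarrow}\gamma)\wedge(\psi\mathbin{\Box\!\!\rightarrow}\gamma)))$, (L4) $(\varphi\mathbin{\Box\!\!\rightarrow}(\psi\land\gamma))\leftrightarrow((\varphi\mathbin{\Box\!\!\rightarrow}\psi)\land(\varphi\mathbin{\Box\!\!\rightarrow}\gamma))$, closed under modus ponens and: if $\vdash\varphi\to\psi$ then $\vdash(\gamma\mathbin{\Box\!\!\rightarrow}\varphi)\to(\gamma\mathbin{\Box\!\!\rightarrow}\psi)$. With $\neg x:=x\to0$, $\varphi\mathbin{\Diamond\!\!\rightarrow}\psi:=\neg(\varphi\mathbin{\Box\!\!\rightarrow}\neg\psi)$,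 $\Box\varphi:=\neg\varphi\mathbin{\Box\!\!\rightarrow}\varphi$, $\Diamond\varphi:=\neg\Box\neg\varphi$, $\varphi\preccurlyeq\psi:=((\varphi\vee\psi)\mathbin{\Diamond\!\!\rightarrow}(\varphi\vee\psi))\to((\varphi\vee\psi)\mathbin{\Diamond\!\!\rightarrow}\varphi)$, $\varphi\prec\psi:=\neg(\psi\preccurlyeq\varphi)$, the axioms are: ($\mathbf W$) $(\varphi\mathbin{\Box\!\!\rightarrow}\psi)\to(\varphi\to\psi)$; ($\mathbf C$) $((\varphi\mathbin{\Box\!\!\rightarrow}\psi)\to(\varphi\to\psi))\wedge(\varphi\wedge\psi)\to(\varphi\mathbin{\Box\!\!\rightarrow}\psi)$; ($\mathbf N$) $\Box\varphi\to\Diamond\varphi$; ($\mathbf T$) $\Box\varphi\to\varphi$; ($\mathbf S$) $(\varphi\mathbin{\Box\!\!\rightarrow}\psi)\vee(\varphi\mathbin{\Box\!\!\rightarrow}\neg\psi)$; ($\mathbf U$) $(\Diamond\varphi\to\Box\Diamond\varphi)\wedge(\Box\varphi\to\Box\Box\varphi)$; ($\mathbf A$) $((\varphi\preccurlyeq\psi)\to\Box(\varphi\preccurlyeq\psi))\wedge((\varphi\prec\psi)\to\Box(\varphi\prec\psi))$. $\mathbf{LVCA}$ is the extension by $\mathbf C$ and $\mathbf A$. Algebraizable is in the sense of Blok–Pigozzi.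
   Formalization: Axiom C is taken with its missing brackets restored, as ((φ□→ψ)→(φ→ψ))∧((φ∧ψ)→(φ□→ψ)); read with ∧ binding tighter than →, LV plus W, C, A would be algebraizable yet differ from LVCA. *)

theory Defs
  imports Main
begin

section \<open>Language\<close>

datatype fm =
    Var nat
  | Falsum  ("\<^bold>0")
  | Verum  ("\<^bold>1")
  | Conj fm fm  (infixr "\<^bold>\<and>" 75)
  | Disj fm fm  (infixr "\<^bold>\<or>" 70)
  | Imp fm fm  (infixr "\<^bold>\<rightarrow>" 65)
  | Cond fm fm  (infixr "\<box>\<rightarrow>" 80)  \<comment> \<open>the counterfactual conditional\<close>

abbreviation Neg :: "fm \<Rightarrow> fm"  ("\<^bold>\<not> _" [90] 90)
  where "\<^bold>\<not> \<phi> \<equiv> \<phi> \<^bold>\<rightarrow> \<^bold>0"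

abbreviation Iff :: "fm \<Rightarrow> fm \<Rightarrow> fm"  (infix "\<^bold>\<leftrightarrow>" 60)
  where "\<phi> \<^bold>\<leftrightarrow> \<psi> \<equiv> (\<phi> \<^bold>\<rightarrow> \<psi>) \<^bold>\<and> (\<psi> \<^bold>\<rightarrow> \<phi>)"

abbreviation Might :: "fm \<Rightarrow> fm \<Rightarrow> fm"  (infixr "\<diamond>\<rightarrow>" 80)
  where "\<phi> \<diamond>\<rightarrow> \<psi> \<equiv> \<^bold>\<not> (\<phi> \<box>\<rightarrow> \<^bold>\<not> \<psi>)"

abbreviation Box :: "fm \<Rightarrow> fm"  ("\<^bold>\<box> _" [90] 90)
  where "\<^bold>\<box> \<phi> \<equiv> \<^bold>\<not> \<phi> \<box>\<rightarrow> \<phi>"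

abbreviation Dia :: "fm \<Rightarrow> fm"  ("\<^bold>\<diamond> _" [90] 90)
  where "\<^bold>\<diamond> \<phi> \<equiv> \<^bold>\<not> (\<^bold>\<box> (\<^bold>\<not> \<phi>))"

abbreviation AsPossible :: "fm \<Rightarrow> fm \<Rightarrow> fm"  (infix "\<^bold>\<preceq>" 80)
  where "\<phi> \<^bold>\<preceq> \<psi> \<equiv> ((\<phi> \<^bold>\<or> \<psi>) \<diamond>\<rightarrow> (\<phi> \<^bold>\<or> \<psi>)) \<^bold>\<rightarrow> ((\<phi> \<^bold>\<or> \<psi>) \<diamond>\<rightarrow> \<phi>)"

abbreviation MorePossible :: "fm \<Rightarrow> fm \<Rightarrow> fm"  (infix "\<^bold>\<prec>" 80)
  where "\<phi> \<^bold>\<prec> \<psi> \<equiv> \<^bold>\<not> (\<psi> \<^bold>\<preceq> \<phi>)"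

primrec subst :: "(nat \<Rightarrow> fm) \<Rightarrow> fm \<Rightarrow> fm" where
  "subst s (Var n) = s n"
| "subst s \<^bold>0 = \<^bold>0"
| "subst s \<^bold>1 = \<^bold>1"
| "subst s (\<phi> \<^bold>\<and> \<psi>) = subst s \<phi> \<^bold>\<and> subst s \<psi>"
| "subst s (\<phi> \<^bold>\<or> \<psi>) = subst s \<phi> \<^bold>\<or> subst s \<psi>"
| "subst s (\<phi> \<^bold>\<rightarrow> \<psi>) = subst s \<phi> \<^bold>\<rightarrow> subst s \<psi>"
| "subst s (\<phi> \<box>\<rightarrow> \<psi>) = subst s \<phi> \<box>\<rightarrow> subst s \<psi>"

primrec vars :: "fm \<Rightarrow> nat set" where
  "vars (Var n) = {n}"
| "vars \<^bold>0 = {}"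
| "vars \<^bold>1 = {}"
| "vars (\<phi> \<^bold>\<and> \<psi>) = vars \<phi> \<union> vars \<psi>"
| "vars (\<phi> \<^bold>\<or> \<psi>) = vars \<phi> \<union> vars \<psi>"
| "vars (\<phi> \<^bold>\<rightarrow> \<psi>) = vars \<phi> \<union> vars \<psi>"
| "vars (\<phi> \<box>\<rightarrow> \<psi>) = vars \<phi> \<union> vars \<psi>"


section \<open>The logic LV and its axiomatic extensions\<close>

inductive_set classical_axioms :: "fm set" where
  "\<phi> \<^bold>\<rightarrow> \<psi> \<^bold>\<rightarrow> \<phi> \<in> classical_axioms"
| "(\<phi> \<^bold>\<rightarrow> \<psi> \<^bold>\<rightarrow> \<gamma>) \<^bold>\<rightarrow> (\<phi> \<^bold>\<rightarrow> \<psi>) \<^bold>\<rightarrow> \<phi> \<^bold>\<rightarrow> \<gamma> \<in> classical_axioms"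
| "\<phi> \<^bold>\<and> \<psi> \<^bold>\<rightarrow> \<phi> \<in> classical_axioms"
| "\<phi> \<^bold>\<and> \<psi> \<^bold>\<rightarrow> \<psi> \<in> classical_axioms"
| "\<phi> \<^bold>\<rightarrow> \<psi> \<^bold>\<rightarrow> \<phi> \<^bold>\<and> \<psi> \<in> classical_axioms"
| "\<phi> \<^bold>\<rightarrow> \<phi> \<^bold>\<or> \<psi> \<in> classical_axioms"
| "\<psi> \<^bold>\<rightarrow> \<phi> \<^bold>\<or> \<psi> \<in> classical_axioms"
| "(\<phi> \<^bold>\<rightarrow> \<gamma>) \<^bold>\<rightarrow> (\<psi> \<^bold>\<rightarrow> \<gamma>) \<^bold>\<rightarrow> \<phi> \<^bold>\<or> \<psi> \<^bold>\<rightarrow> \<gamma> \<in> classical_axioms"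
| "\<^bold>0 \<^bold>\<rightarrow> \<phi> \<in> classical_axioms"
| "\<^bold>1 \<in> classical_axioms"
| "\<^bold>\<not> \<^bold>\<not> \<phi> \<^bold>\<rightarrow> \<phi> \<in> classical_axioms"

inductive_set LV_axioms :: "fm set" where
  L1: "\<phi> \<box>\<rightarrow> \<phi> \<in> LV_axioms"
| L2: "((\<phi> \<box>\<rightarrow> \<psi>) \<^bold>\<and> (\<psi> \<box>\<rightarrow> \<phi>)) \<^bold>\<rightarrow> ((\<phi> \<box>\<rightarrow> \<gamma>) \<^bold>\<leftrightarrow> (\<psi> \<box>\<rightarrow> \<gamma>)) \<in> LV_axioms"
| L3: "((\<phi> \<^bold>\<or> \<psi>) \<box>\<rightarrow> \<phi>) \<^bold>\<or> ((\<phi> \<^bold>\<or> \<psi>) \<box>\<rightarrow> \<psi>) \<^bold>\<or>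
       (((\<phi> \<^bold>\<or> \<psi>) \<box>\<rightarrow> \<gamma>) \<^bold>\<leftrightarrow> ((\<phi> \<box>\<rightarrow> \<gamma>) \<^bold>\<and> (\<psi> \<box>\<rightarrow> \<gamma>))) \<in> LV_axioms"
| L4: "(\<phi> \<box>\<rightarrow> (\<psi> \<^bold>\<and> \<gamma>)) \<^bold>\<leftrightarrow> ((\<phi> \<box>\<rightarrow> \<psi>) \<^bold>\<and> (\<phi> \<box>\<rightarrow> \<gamma>)) \<in> LV_axioms"

datatype lewis_axiom = Ax_W | Ax_C | Ax_N | Ax_T | Ax_S | Ax_U | Ax_A

text \<open>
  Centering is read as the conjunction of weak centering with
  \<open>\<phi> \<and> \<psi> \<rightarrow> (\<phi> \<box>\<rightarrow> \<psi>)\<close>. Grouping the formula as \<open>(\<dots> \<and> (\<phi> \<and> \<psi>)) \<rightarrow> (\<phi> \<box>\<rightarrow> \<psi>)\<close> instead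
  would make its first conjunct redundant.
\<close>

primrec instances :: "lewis_axiom \<Rightarrow> fm set" where
  "instances Ax_W = {(\<phi> \<box>\<rightarrow> \<psi>) \<^bold>\<rightarrow> (\<phi> \<^bold>\<rightarrow> \<psi>) | \<phi> \<psi>. True}"
| "instances Ax_C = {((\<phi> \<box>\<rightarrow> \<psi>) \<^bold>\<rightarrow> (\<phi> \<^bold>\<rightarrow> \<psi>)) \<^bold>\<and> ((\<phi> \<^bold>\<and> \<psi>) \<^bold>\<rightarrow> (\<phi> \<box>\<rightarrow> \<psi>)) | \<phi> \<psi>. True}"
| "instances Ax_N = {\<^bold>\<box> \<phi> \<^bold>\<rightarrow> \<^bold>\<diamond> \<phi> | \<phi>. True}"
| "instances Ax_T = {\<^bold>\<box> \<phi> \<^bold>\<rightarrow> \<phi> | \<phi>. True}"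
| "instances Ax_S = {(\<phi> \<box>\<rightarrow> \<psi>) \<^bold>\<or> (\<phi> \<box>\<rightarrow> \<^bold>\<not> \<psi>) | \<phi> \<psi>. True}"
| "instances Ax_U = {(\<^bold>\<diamond> \<phi> \<^bold>\<rightarrow> \<^bold>\<box> (\<^bold>\<diamond> \<phi>)) \<^bold>\<and> (\<^bold>\<box> \<phi> \<^bold>\<rightarrow> \<^bold>\<box> (\<^bold>\<box> \<phi>)) | \<phi>. True}"
| "instances Ax_A = {((\<phi> \<^bold>\<preceq> \<psi>) \<^bold>\<rightarrow> \<^bold>\<box> (\<phi> \<^bold>\<preceq> \<psi>)) \<^bold>\<and> ((\<phi> \<^bold>\<prec> \<psi>) \<^bold>\<rightarrow> \<^bold>\<box> (\<phi> \<^bold>\<prec> \<psi>)) | \<phi> \<psi>. True}"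

text \<open>
  \<open>LV_ext X\<close> is the consequence relation of \<open>LV\<close> extended by the axioms in \<open>X\<close>. The rule for
  \<open>\<box>\<rightarrow>\<close> applies to theorems only, including those obtained from the axioms in \<open>X\<close>. The
  lemmas below show that this is the smallest finitary consequence relation as described.
\<close>

inductive LV_ext :: "lewis_axiom set \<Rightarrow> fm set \<Rightarrow> fm \<Rightarrow> bool" for X where
  premise: "\<phi> \<in> \<Gamma> \<Longrightarrow> LV_ext X \<Gamma> \<phi>"
| classical: "\<phi> \<in> classical_axioms \<Longrightarrow> LV_ext X \<Gamma> \<phi>"
| conditional: "\<phi> \<in> LV_axioms \<Longrightarrow> LV_ext X \<Gamma> \<phi>"
| extension: "a \<in> X \<Longrightarrow> \<phi> \<in> instances a \<Longrightarrow> LV_ext X \<Gamma> \<phi>"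
| modus_ponens: "LV_ext X \<Gamma> (\<phi> \<^bold>\<rightarrow> \<psi>) \<Longrightarrow> LV_ext X \<Gamma> \<phi> \<Longrightarrow> LV_ext X \<Gamma> \<psi>"
| cond_mono: "LV_ext X {} (\<phi> \<^bold>\<rightarrow> \<psi>) \<Longrightarrow> LV_ext X \<Gamma> ((\<gamma> \<box>\<rightarrow> \<phi>) \<^bold>\<rightarrow> (\<gamma> \<box>\<rightarrow> \<psi>))"

abbreviation LV :: "fm set \<Rightarrow> fm \<Rightarrow> bool"
  where "LV \<equiv> LV_ext {}"

abbreviation LVCA :: "fm set \<Rightarrow> fm \<Rightarrow> bool"
  where "LVCA \<equiv> LV_ext {Ax_C, Ax_A}"

definition consequence_relation :: "(fm set \<Rightarrow> fm \<Rightarrow> bool) \<Rightarrow> bool" where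
  "consequence_relation R \<longleftrightarrow>
     (\<forall>\<Gamma> \<phi>. \<phi> \<in> \<Gamma> \<longrightarrow> R \<Gamma> \<phi>) \<and>
     (\<forall>\<Gamma> \<Gamma>' \<phi>. R \<Gamma> \<phi> \<longrightarrow> (\<forall>\<psi>\<in>\<Gamma>. R \<Gamma>' \<psi>) \<longrightarrow> R \<Gamma>' \<phi>)"

definition structural :: "(fm set \<Rightarrow> fm \<Rightarrow> bool) \<Rightarrow> bool" where
  "structural R \<longleftrightarrow> (\<forall>s \<Gamma> \<phi>. R \<Gamma> \<phi> \<longrightarrow> R (subst s ` \<Gamma>) (subst s \<phi>))"

definition finitary :: "(fm set \<Rightarrow> fm \<Rightarrow> bool) \<Rightarrow> bool" where
  "finitary R \<longleftrightarrow> (\<forall>\<Gamma> \<phi>. R \<Gamma> \<phi> \<longrightarrow> (\<exists>\<Gamma>'. finite \<Gamma>' \<and> \<Gamma>' \<subseteq> \<Gamma> \<and> R \<Gamma>' \<phi>))"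

definition LV_closed :: "lewis_axiom set \<Rightarrow> (fm set \<Rightarrow> fm \<Rightarrow> bool) \<Rightarrow> bool" where
  "LV_closed X R \<longleftrightarrow>
     (\<forall>\<phi> \<in> classical_axioms \<union> LV_axioms \<union> (\<Union>a\<in>X. instances a). R {} \<phi>) \<and>
     (\<forall>\<phi> \<psi>. R {\<phi>, \<phi> \<^bold>\<rightarrow> \<psi>} \<psi>) \<and>
     (\<forall>\<phi> \<psi> \<gamma>. R {} (\<phi> \<^bold>\<rightarrow> \<psi>) \<longrightarrow> R {} ((\<gamma> \<box>\<rightarrow> \<phi>) \<^bold>\<rightarrow> (\<gamma> \<box>\<rightarrow> \<psi>)))"

lemma LV_ext_cut:
  assumes "LV_ext X \<Gamma> \<phi>" and "\<forall>\<psi>\<in>\<Gamma>. LV_ext X \<Gamma>' \<psi>"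
  shows "LV_ext X \<Gamma>' \<phi>"
  using assms by (induction arbitrary: \<Gamma>') (auto intro: LV_ext.intros)

lemma LV_ext_mono:
  "LV_ext X \<Gamma> \<phi> \<Longrightarrow> \<Gamma> \<subseteq> \<Gamma>' \<Longrightarrow> LV_ext X \<Gamma>' \<phi>"
  by (erule LV_ext_cut) (auto intro: LV_ext.premise)

lemma LV_ext_consequence_relation: "consequence_relation (LV_ext X)"
  unfolding consequence_relation_def using LV_ext.premise LV_ext_cut by blast

lemma LV_ext_finitary: "finitary (LV_ext X)"
proof -
  have "\<exists>\<Gamma>'. finite \<Gamma>' \<and> \<Gamma>' \<subseteq> \<Gamma> \<and> LV_ext X \<Gamma>' \<phi>" if "LV_ext X \<Gamma> \<phi>" for \<Gamma> \<phi>
    using that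
  proof induction
    case (premise \<phi> \<Gamma>)
    then show ?case by (intro exI[of _ "{\<phi>}"]) (auto intro: LV_ext.premise)
  next
    case (modus_ponens \<Gamma> \<phi> \<psi>)
    then obtain A B where "finite A" "A \<subseteq> \<Gamma>" "LV_ext X A (\<phi> \<^bold>\<rightarrow> \<psi>)"
      and "finite B" "B \<subseteq> \<Gamma>" "LV_ext X B \<phi>" by blast
    then show ?case
      by (intro exI[of _ "A \<union> B"])
        (auto intro: LV_ext.modus_ponens LV_ext_mono)
  qed (blast intro: LV_ext.intros)+
  then show ?thesis unfolding finitary_def by blast
qed

lemma subst_classical: "\<phi> \<in> classical_axioms \<Longrightarrow> subst s \<phi> \<in> classical_axioms"
  by (induction rule: classical_axioms.induct) (auto intro: classical_axioms.intros)

lemma subst_LV_axioms: "\<phi> \<in> LV_axioms \<Longrightarrow> subst s \<phi> \<in> LV_axioms"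
  by (induction rule: LV_axioms.induct) (auto intro: LV_axioms.intros)

lemma subst_instances: "\<phi> \<in> instances a \<Longrightarrow> subst s \<phi> \<in> instances a"
  by (cases a) auto

lemma LV_ext_structural: "structural (LV_ext X)"
proof -
  have "LV_ext X (subst s ` \<Gamma>) (subst s \<phi>)" if "LV_ext X \<Gamma> \<phi>" for s \<Gamma> \<phi>
    using that
    by induction
      (auto intro: LV_ext.intros subst_classical subst_LV_axioms subst_instances)
  then show ?thesis unfolding structural_def by blast
qed

lemma LV_ext_closed: "LV_closed X (LV_ext X)"
  unfolding LV_closed_def
proof (intro conjI allI)
  show "LV_ext X {\<phi>, \<phi> \<^bold>\<rightarrow> \<psi>} \<psi>" for \<phi> \<psi>
    by (rule LV_ext.modus_ponens[of _ _ \<phi>]) (auto intro: LV_ext.premise)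
qed (auto intro: LV_ext.intros)

lemma LV_ext_least:
  assumes "consequence_relation R" and "LV_closed X R" and "LV_ext X \<Gamma> \<phi>"
  shows "R \<Gamma> \<phi>"
proof -
  have hyp: "R \<Gamma> \<phi>" if "\<phi> \<in> \<Gamma>" for \<Gamma> \<phi>
    using assms(1) that unfolding consequence_relation_def by blast
  have cut: "R \<Gamma>' \<phi>" if "R \<Gamma> \<phi>" "\<forall>\<psi>\<in>\<Gamma>. R \<Gamma>' \<psi>" for \<Gamma> \<Gamma>' \<phi>
    using assms(1) that unfolding consequence_relation_def by blast
  have weaken: "R \<Gamma> \<phi>" if "R {} \<phi>" for \<Gamma> \<phi>
    using cut that by blast
  show ?thesis using assms(3)
  proof induction
    case (modus_ponens \<Gamma> \<phi> \<psi>)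
    have "R {\<phi>, \<phi> \<^bold>\<rightarrow> \<psi>} \<psi>" using assms(2) unfolding LV_closed_def by blast
    then show ?case by (rule cut) (use modus_ponens.IH in auto)
  next
    case (cond_mono \<phi> \<psi> \<Gamma> \<gamma>)
    then show ?case using assms(2) weaken unfolding LV_closed_def by blast
  qed (use assms(2) in \<open>auto simp: LV_closed_def intro: hyp weaken\<close>)
qed


section \<open>Algebraizability in the sense of Blok and Pigozzi\<close>

record 'a alg =
  univ :: "'a set"
  zero_op :: 'a
  one_op :: 'a
  meet_op :: "'a \<Rightarrow> 'a \<Rightarrow> 'a"
  join_op :: "'a \<Rightarrow> 'a \<Rightarrow> 'a"
  imp_op :: "'a \<Rightarrow> 'a \<Rightarrow> 'a"
  cond_op :: "'a \<Rightarrow> 'a \<Rightarrow> 'a"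

definition is_algebra :: "'a alg \<Rightarrow> bool" where
  "is_algebra A \<longleftrightarrow> zero_op A \<in> univ A \<and> one_op A \<in> univ A \<and>
     (\<forall>x\<in>univ A. \<forall>y\<in>univ A. meet_op A x y \<in> univ A \<and> join_op A x y \<in> univ A \<and>
        imp_op A x y \<in> univ A \<and> cond_op A x y \<in> univ A)"

primrec eval :: "'a alg \<Rightarrow> (nat \<Rightarrow> 'a) \<Rightarrow> fm \<Rightarrow> 'a" where
  "eval A h (Var n) = h n"
| "eval A h \<^bold>0 = zero_op A"
| "eval A h \<^bold>1 = one_op A"
| "eval A h (\<phi> \<^bold>\<and> \<psi>) = meet_op A (eval A h \<phi>) (eval A h \<psi>)"
| "eval A h (\<phi> \<^bold>\<or> \<psi>) = join_op A (eval A h \<phi>) (eval A h \<psi>)"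
| "eval A h (\<phi> \<^bold>\<rightarrow> \<psi>) = imp_op A (eval A h \<phi>) (eval A h \<psi>)"
| "eval A h (\<phi> \<box>\<rightarrow> \<psi>) = cond_op A (eval A h \<phi>) (eval A h \<psi>)"

type_synonym equation = "fm \<times> fm"

definition eq_consequence :: "'a alg set \<Rightarrow> equation set \<Rightarrow> equation \<Rightarrow> bool" where
  "eq_consequence K E e \<longleftrightarrow>
     (\<forall>A\<in>K. \<forall>h. range h \<subseteq> univ A \<longrightarrow>
        (\<forall>(\<alpha>, \<beta>)\<in>E. eval A h \<alpha> = eval A h \<beta>) \<longrightarrow> eval A h (fst e) = eval A h (snd e))"

text \<open>
  A finite system \<open>\<tau>\<close> of defining equations uses the variable \<open>Var 0\<close> only; a finite system \<open>\<Delta>\<close> of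
  equivalence formulas uses \<open>Var 0\<close> and \<open>Var 1\<close> only.
\<close>

definition eqs_at :: "equation set \<Rightarrow> fm \<Rightarrow> equation set" where
  "eqs_at \<tau> \<phi> = (\<lambda>(\<delta>, \<epsilon>). (subst (\<lambda>_. \<phi>) \<delta>, subst (\<lambda>_. \<phi>) \<epsilon>)) ` \<tau>"

definition fms_at :: "fm set \<Rightarrow> fm \<Rightarrow> fm \<Rightarrow> fm set" where
  "fms_at \<Delta> \<phi> \<psi> = subst (\<lambda>n. if n = 0 then \<phi> else \<psi>) ` \<Delta>"

definition equivalent_algebraic_semantics ::
  "(fm set \<Rightarrow> fm \<Rightarrow> bool) \<Rightarrow> 'a alg set \<Rightarrow> equation set \<Rightarrow> fm set \<Rightarrow> bool" where
  "equivalent_algebraic_semantics L K \<tau> \<Delta> \<longleftrightarrow>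
     (\<forall>A\<in>K. is_algebra A) \<and>
     finite \<tau> \<and> (\<forall>(\<delta>, \<epsilon>)\<in>\<tau>. vars \<delta> \<union> vars \<epsilon> \<subseteq> {0}) \<and>
     finite \<Delta> \<and> (\<forall>\<chi>\<in>\<Delta>. vars \<chi> \<subseteq> {0, 1}) \<and>
     (\<forall>\<Gamma> \<phi>. L \<Gamma> \<phi> \<longleftrightarrow>
        (\<forall>e\<in>eqs_at \<tau> \<phi>. eq_consequence K (\<Union>\<psi>\<in>\<Gamma>. eqs_at \<tau> \<psi>) e)) \<and>
     (\<forall>\<phi> \<psi>. (\<forall>e\<in>(\<Union>\<chi>\<in>fms_at \<Delta> \<phi> \<psi>. eqs_at \<tau> \<chi>). eq_consequence K {(\<phi>, \<psi>)} e) \<and>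
            eq_consequence K (\<Union>\<chi>\<in>fms_at \<Delta> \<phi> \<psi>. eqs_at \<tau> \<chi>) (\<phi>, \<psi>))"

text \<open>
  \<open>K\<close> ranges over arbitrary classes of algebras whose universes are subsets of \<open>'a\<close>. HOL cannot
  quantify over types inside a formula, so \<open>'a\<close> is a parameter. For infinite \<open>'a\<close> this is no
  restriction: there are countably many formulas, so \<open>eq_consequence K\<close> is determined by the
  countable subalgebras of members of \<open>K\<close>, and these have isomorphic copies inside \<open>'a\<close>.
\<close>

definition algebraizable :: "'a itself \<Rightarrow> (fm set \<Rightarrow> fm \<Rightarrow> bool) \<Rightarrow> bool" where
  "algebraizable _ L \<longleftrightarrow>
     (\<exists>(K :: 'a alg set) \<tau> \<Delta>. equivalent_algebraic_semantics L K \<tau> \<Delta>)"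

end

theory Submission
  imports Defs
begin

text \<open>
  If \<open>\<tau>\<close> and \<open>\<Delta>\<close> witness algebraizability, then in any model where \<open>\<box>\<close> is the universal modality,
  \<open>\<Delta>(\<delta>, \<epsilon>)\<close> holds at one world iff \<open>\<delta>\<close> and \<open>\<epsilon>\<close> are true at the same worlds, hence iff it holds at
  every world. As \<open>x\<close> and \<open>\<Delta>(\<tau>(x))\<close> are interderivable, a variable true at one world is then true at
  all of them, which is absurd if there are two worlds. When \<open>\<A>\<close> is present together with \<open>\<C>\<close>, or
  with both \<open>\<W>\<close> and \<open>\<S>\<close>, the conditional collapses to material implication and the logic is classical
  logic, which is \<open>LVCA\<close> and is algebraized by the two-element algebra. In every other case one of
  three frames with two worlds validates the axioms.
\<close>

section \<open>Ranked frames\<close>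

definition minimal :: "('w \<Rightarrow> nat) \<Rightarrow> 'w set \<Rightarrow> 'w set" where
  "minimal \<rho> S = {u \<in> S. \<forall>u' \<in> S. \<rho> u \<le> \<rho> u'}"

lemma minimal_subset: "minimal \<rho> S \<subseteq> S"
  by (auto simp: minimal_def)

text \<open>Ranks are natural numbers, so the limit assumption holds: every nonempty set has a
  closest world.\<close>

lemma minimal_empty_iff [simp]: "minimal \<rho> S = {} \<longleftrightarrow> S = {}"
proof
  assume "minimal \<rho> S = {}"
  then show "S = {}"
    using ex_has_least_nat[of "\<lambda>u. u \<in> S" _ \<rho>] by (fastforce simp: minimal_def)
qed (auto simp: minimal_def)

text \<open>The semantic content of L2. A closest world of each set lies in the other, so the two
  least ranks coincide.\<close>

lemma minimal_cong:
  "minimal \<rho> S \<subseteq> T \<Longrightarrow> minimal \<rho> T \<subseteq> S \<Longrightarrow> minimal \<rho> S = minimal \<rho> T"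
proof -
  have "minimal \<rho> S \<subseteq> minimal \<rho> T" if "minimal \<rho> S \<subseteq> T" "minimal \<rho> T \<subseteq> S" for S T
  proof
    fix u assume u: "u \<in> minimal \<rho> S"
    then obtain t where "t \<in> minimal \<rho> T"
      using \<open>minimal \<rho> S \<subseteq> T\<close> minimal_empty_iff[of \<rho> T] by blast
    moreover from this have "\<rho> u \<le> \<rho> t"
      using u \<open>minimal \<rho> T \<subseteq> S\<close> by (auto simp: minimal_def)
    ultimately show "u \<in> minimal \<rho> T"
      using u \<open>minimal \<rho> S \<subseteq> T\<close> by (auto simp: minimal_def intro: order_trans)
  qed
  then show "minimal \<rho> S \<subseteq> T \<Longrightarrow> minimal \<rho> T \<subseteq> S \<Longrightarrow> minimal \<rho> S = minimal \<rho> T"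
    by blast
qed

text \<open>The semantic content of L3. Outside the first two disjuncts, both sets attain the least
  rank of the union.\<close>

lemma minimal_Un:
  assumes "\<not> minimal \<rho> (S \<union> T) \<subseteq> S" and "\<not> minimal \<rho> (S \<union> T) \<subseteq> T"
  shows "minimal \<rho> (S \<union> T) = minimal \<rho> S \<union> minimal \<rho> T"
proof -
  obtain t s where "t \<in> T" "s \<in> S" and t: "\<forall>u \<in> S \<union> T. \<rho> t \<le> \<rho> u" and s: "\<forall>u \<in> S \<union> T. \<rho> s \<le> \<rho> u"
    using assms unfolding minimal_def by blast
  then show ?thesis
    unfolding minimal_def by (auto intro: order_trans)
qed

text \<open>All worlds are accessible from \<open>w\<close>; its spheres are the sublevel sets of \<open>r w\<close>.\<close>

definition complex_alg :: "('w \<Rightarrow> 'w \<Rightarrow> nat) \<Rightarrow> 'w set alg" where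
  "complex_alg r = \<lparr>univ = UNIV, zero_op = {}, one_op = UNIV, meet_op = (\<inter>), join_op = (\<union>),
     imp_op = (\<lambda>S T. - S \<union> T), cond_op = (\<lambda>S T. {w. minimal (r w) S \<subseteq> T})\<rparr>"

lemma complex_alg_simps [simp]:
  "zero_op (complex_alg r) = {}"
  "one_op (complex_alg r) = UNIV"
  "meet_op (complex_alg r) S T = S \<inter> T"
  "join_op (complex_alg r) S T = S \<union> T"
  "imp_op (complex_alg r) S T = - S \<union> T"
  "cond_op (complex_alg r) S T = {w. minimal (r w) S \<subseteq> T}"
  by (simp_all add: complex_alg_def)

definition valid :: "('w \<Rightarrow> 'w \<Rightarrow> nat) \<Rightarrow> fm \<Rightarrow> bool" where
  "valid r \<phi> \<longleftrightarrow> (\<forall>v. eval (complex_alg r) v \<phi> = UNIV)"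

lemma eval_subst: "eval A h (subst s \<phi>) = eval A (\<lambda>n. eval A h (s n)) \<phi>"
  by (induction \<phi>) auto

text \<open>The conditional from \<open>- S\<close> to \<open>S\<close> can only hold vacuously, so
  \<open>\<box>\<close> is the universal modality whatever the ranks are.\<close>

lemma eval_Box: "eval (complex_alg r) v (\<^bold>\<box> \<phi>) = {_. eval (complex_alg r) v \<phi> = UNIV}"
proof -
  have "minimal \<rho> (- S) \<subseteq> S \<longleftrightarrow> S = UNIV" for \<rho> :: "'a \<Rightarrow> nat" and S
    using minimal_subset[of \<rho> "- S"] minimal_empty_iff[of \<rho> "- S"] by blast
  then show ?thesis by simp
qed

section \<open>Soundness, and frame conditions for the extension axioms\<close>

lemma valid_classical: "\<phi> \<in> classical_axioms \<Longrightarrow> valid r \<phi>"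
  unfolding valid_def by (induction rule: classical_axioms.induct) auto

lemma valid_LV_axioms: "\<phi> \<in> LV_axioms \<Longrightarrow> valid r \<phi>"
proof (induction rule: LV_axioms.induct)
  case (L1 \<phi>)
  then show ?case by (simp add: valid_def minimal_subset)
next
  case (L2 \<phi> \<psi> \<gamma>)
  let ?e = "eval (complex_alg r)"
  show ?case
    unfolding valid_def
  proof (intro allI UNIV_eq_I[symmetric])
    fix v w
    show "w \<in> ?e v (((\<phi> \<box>\<rightarrow> \<psi>) \<^bold>\<and> (\<psi> \<box>\<rightarrow> \<phi>)) \<^bold>\<rightarrow> ((\<phi> \<box>\<rightarrow> \<gamma>) \<^bold>\<leftrightarrow> (\<psi> \<box>\<rightarrow> \<gamma>)))"
      using minimal_cong[of "r w" "?e v \<phi>" "?e v \<psi>"] by auto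
  qed
next
  case (L3 \<phi> \<psi> \<gamma>)
  let ?e = "eval (complex_alg r)"
  show ?case
    unfolding valid_def
  proof (intro allI UNIV_eq_I[symmetric])
    fix v w
    show "w \<in> ?e v (((\<phi> \<^bold>\<or> \<psi>) \<box>\<rightarrow> \<phi>) \<^bold>\<or> ((\<phi> \<^bold>\<or> \<psi>) \<box>\<rightarrow> \<psi>) \<^bold>\<or>
        (((\<phi> \<^bold>\<or> \<psi>) \<box>\<rightarrow> \<gamma>) \<^bold>\<leftrightarrow> ((\<phi> \<box>\<rightarrow> \<gamma>) \<^bold>\<and> (\<psi> \<box>\<rightarrow> \<gamma>))))"
      using minimal_Un[of "r w" "?e v \<phi>" "?e v \<psi>"] by auto
  qed
next
  case (L4 \<phi> \<psi> \<gamma>)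
  then show ?case by (auto simp: valid_def)
qed

text \<open>Consequence is local, at the single world \<open>w\<close>. The case
  \<open>cond_mono\<close> still goes through because its premise is a theorem, so the induction
  hypothesis holds at every world.\<close>

lemma soundness:
  assumes "LV_ext X \<Gamma> \<phi>" and "\<And>a \<phi>. a \<in> X \<Longrightarrow> \<phi> \<in> instances a \<Longrightarrow> valid r \<phi>"
    and "\<forall>\<psi> \<in> \<Gamma>. w \<in> eval (complex_alg r) v \<psi>"
  shows "w \<in> eval (complex_alg r) v \<phi>"
  using assms(1,3)
proof (induction arbitrary: v w)
  case (cond_mono \<phi> \<psi> \<Gamma> \<gamma>)
  have "eval (complex_alg r) v \<phi> \<subseteq> eval (complex_alg r) v \<psi>"
    using cond_mono.IH[of _ v] by auto
  then show ?case by auto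
qed (use valid_classical[of _ r] valid_LV_axioms[of _ r] assms(2) in \<open>auto simp: valid_def\<close>)

text \<open>N, T and U only involve \<open>\<box>\<close>, so by \<open>eval_Box\<close> they hold
  on every frame.\<close>

lemma valid_N: "\<phi> \<in> instances Ax_N \<Longrightarrow> valid r \<phi>"
  by (auto simp: valid_def eval_Box simp del: eval.simps(7))

lemma valid_T: "\<phi> \<in> instances Ax_T \<Longrightarrow> valid r \<phi>"
  by (auto simp: valid_def eval_Box simp del: eval.simps(7))

lemma valid_U: "\<phi> \<in> instances Ax_U \<Longrightarrow> valid r \<phi>"
  by (auto simp: valid_def eval_Box simp del: eval.simps(7))

lemma valid_W:
  assumes "\<And>w u. r w w \<le> r w u" and "\<phi> \<in> instances Ax_W"
  shows "valid r \<phi>"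
proof -
  have "minimal (r w) S \<subseteq> T \<Longrightarrow> w \<in> S \<Longrightarrow> w \<in> T" for w S T
    using assms(1) by (auto simp: minimal_def)
  then show ?thesis using assms(2) by (auto simp: valid_def)
qed

text \<open>A world that is strictly closest to itself is the only minimal element of any set
  containing it.\<close>

lemma valid_C:
  assumes "\<forall>w u. u \<noteq> w \<longrightarrow> r w w < r w u" and "\<phi> \<in> instances Ax_C"
  shows "valid r \<phi>"
proof -
  have le: "r w w \<le> r w u" for w u
    using assms(1) by (cases "u = w") (auto simp: less_imp_le)
  have "u = w" if "r w u \<le> r w w" for w u
    using assms(1) that by (metis not_le)
  then have "minimal (r w) S = {w}" if "w \<in> S" for w S
    using that le by (auto simp: minimal_def)
  then show ?thesis using assms(2) by (auto simp: valid_def)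
qed

text \<open>Without ties in rank there is at most one closest world, which decides every
  consequent.\<close>

lemma valid_S:
  assumes "\<And>w. inj (r w)" and "\<phi> \<in> instances Ax_S"
  shows "valid r \<phi>"
proof -
  have "u = u'" if "u \<in> minimal (r w) S" "u' \<in> minimal (r w) S" for u u' w S
    using that by (intro injD[OF assms(1)[of w]]) (auto simp: minimal_def intro: antisym)
  then have "minimal (r w) S \<subseteq> T \<or> minimal (r w) S \<subseteq> - T" for w S T
    by blast
  then show ?thesis using assms(2) by (auto simp: valid_def)
qed

text \<open>With one ranking shared by all worlds, comparisons of possibility have the same truth
  value everywhere.\<close>

lemma valid_A:
  assumes "\<And>w w'. r w = r w'" and "\<phi> \<in> instances Ax_A"
  shows "valid r \<phi>"
proof -
  obtain \<rho> where r: "r = (\<lambda>_. \<rho>)" using assms(1) by metis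
  have "eval (complex_alg r) v (\<phi> \<^bold>\<preceq> \<psi>) \<in> {{}, UNIV}" for v \<phi> \<psi>
    by (simp add: r)
  \<comment> \<open>To be used with \<open>\<chi>\<close> as \<open>\<phi> \<preceq> \<psi>\<close>
    and \<open>\<chi>'\<close> as \<open>\<psi> \<preceq> \<phi>\<close>, whose negation is
    \<open>\<phi> \<prec> \<psi>\<close>.\<close>
  moreover have "eval (complex_alg r) v ((\<chi> \<^bold>\<rightarrow> \<^bold>\<box> \<chi>) \<^bold>\<and> (\<^bold>\<not> \<chi>' \<^bold>\<rightarrow> \<^bold>\<box> (\<^bold>\<not> \<chi>'))) = UNIV"
    if "eval (complex_alg r) v \<chi> \<in> {{}, UNIV}" "eval (complex_alg r) v \<chi>' \<in> {{}, UNIV}"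
    for v \<chi> \<chi>'
    using that by (auto simp: eval_Box simp del: eval.simps(7))
  ultimately show ?thesis using assms(2) unfolding valid_def instances.simps by blast
qed


section \<open>Algebraizability fails on frames with two worlds\<close>

lemma equivalent_algebraic_semanticsD:
  assumes "equivalent_algebraic_semantics L K \<tau> \<Delta>"
  shows "L \<Gamma> \<phi> \<longleftrightarrow> (\<forall>e \<in> eqs_at \<tau> \<phi>. eq_consequence K (\<Union>\<psi>\<in>\<Gamma>. eqs_at \<tau> \<psi>) e)"
    and "\<chi> \<in> fms_at \<Delta> \<phi> \<psi> \<Longrightarrow> e \<in> eqs_at \<tau> \<chi> \<Longrightarrow> eq_consequence K {(\<phi>, \<psi>)} e"
    and "eq_consequence K (\<Union>\<chi>\<in>fms_at \<Delta> \<phi> \<psi>. eqs_at \<tau> \<chi>) (\<phi>, \<psi>)"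
  using assms by (simp_all add: equivalent_algebraic_semantics_def)

lemma eq_consequence_cut:
  "eq_consequence K E e \<Longrightarrow> (\<And>e'. e' \<in> E \<Longrightarrow> eq_consequence K E' e') \<Longrightarrow> eq_consequence K E' e"
  unfolding eq_consequence_def by (simp add: split_beta)

lemma eq_consequence_premise: "e \<in> E \<Longrightarrow> eq_consequence K E e"
  unfolding eq_consequence_def by fastforce

lemma equivalence_refl:
  assumes "equivalent_algebraic_semantics L K \<tau> \<Delta>" and "\<chi> \<in> fms_at \<Delta> \<phi> \<phi>"
  shows "L {} \<chi>"
  using equivalent_algebraic_semanticsD(2)[OF assms]
  by (auto simp: equivalent_algebraic_semanticsD(1)[OF assms(1)] eq_consequence_def)

text \<open>\<open>\<Delta>(\<phi>, \<psi>)\<close> forces \<open>\<phi>\<close> and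
  \<open>\<psi>\<close> to be equal in \<open>K\<close>, so in the theorem
  \<open>\<theta>(\<psi>, \<psi>)\<close> the first argument may be replaced by
  \<open>\<phi>\<close>.\<close>

lemma equivalence_detachment:
  fixes K :: "'a alg set"
  assumes sem: "equivalent_algebraic_semantics L K \<tau> \<Delta>"
    and taut: "L {} (subst (\<lambda>_. \<psi>) \<theta>)"
  shows "L (fms_at \<Delta> \<phi> \<psi>) (subst (\<lambda>n. if n = 0 then \<phi> else \<psi>) \<theta>)"
proof -
  note D = equivalent_algebraic_semanticsD[OF sem]
  have "eq_consequence K {(\<phi>, \<psi>)} e"
    if "e \<in> eqs_at \<tau> (subst (\<lambda>n. if n = 0 then \<phi> else \<psi>) \<theta>)" for e
  proof -
    let ?at = "\<lambda>\<phi> \<alpha>. subst (\<lambda>_. subst (\<lambda>n. if n = 0 then \<phi> else \<psi>) \<theta>) \<alpha>"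
    from that obtain \<delta> \<epsilon> where e: "e = (?at \<phi> \<delta>, ?at \<phi> \<epsilon>)" and "(\<delta>, \<epsilon>) \<in> \<tau>"
      by (auto simp: eqs_at_def)
    then have "eq_consequence K {} (?at \<psi> \<delta>, ?at \<psi> \<epsilon>)"
      using taut unfolding D(1)[of "{}"] eqs_at_def by force
    moreover have "eval A h (?at \<phi> \<alpha>) = eval A h (?at \<psi> \<alpha>)" if "eval A h \<phi> = eval A h \<psi>"
      for A :: "'a alg" and h \<alpha>
      using that by (simp add: eval_subst if_distrib cong: if_cong)
    ultimately show ?thesis unfolding e eq_consequence_def by auto
  qed
  then show ?thesis
    unfolding D(1) by (auto intro: eq_consequence_cut D(3))
qed

text \<open>Together: \<open>\<phi>\<close> is interderivable with
  \<open>\<Delta>(\<tau>(\<phi>))\<close>. Both parts translate to \<open>K\<close> and cancel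
  \<open>\<Delta>\<close> against equality there.\<close>

lemma defining_equations:
  assumes sem: "equivalent_algebraic_semantics L K \<tau> \<Delta>"
  shows "(\<delta>, \<epsilon>) \<in> eqs_at \<tau> \<phi> \<Longrightarrow> \<chi> \<in> fms_at \<Delta> \<delta> \<epsilon> \<Longrightarrow> L {\<phi>} \<chi>"
    and "L (\<Union>(\<delta>, \<epsilon>)\<in>eqs_at \<tau> \<phi>. fms_at \<Delta> \<delta> \<epsilon>) \<phi>"
proof -
  note D = equivalent_algebraic_semanticsD[OF sem]
  show "L {\<phi>} \<chi>" if "(\<delta>, \<epsilon>) \<in> eqs_at \<tau> \<phi>" "\<chi> \<in> fms_at \<Delta> \<delta> \<epsilon>"
    unfolding D(1) using that by (auto intro: eq_consequence_cut[OF D(2)] eq_consequence_premise)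
  show "L (\<Union>(\<delta>, \<epsilon>)\<in>eqs_at \<tau> \<phi>. fms_at \<Delta> \<delta> \<epsilon>) \<phi>"
    unfolding D(1)
  proof
    fix e assume e: "e \<in> eqs_at \<tau> \<phi>"
    obtain \<delta> \<epsilon> where "e = (\<delta>, \<epsilon>)" by fastforce
    then have "(\<Union>\<chi>\<in>fms_at \<Delta> \<delta> \<epsilon>. eqs_at \<tau> \<chi>) \<subseteq>
        (\<Union>\<chi>\<in>\<Union>(\<delta>, \<epsilon>)\<in>eqs_at \<tau> \<phi>. fms_at \<Delta> \<delta> \<epsilon>. eqs_at \<tau> \<chi>)"
      using e by blast
    then show "eq_consequence K (\<Union>\<chi>\<in>\<Union>(\<delta>, \<epsilon>)\<in>eqs_at \<tau> \<phi>. fms_at \<Delta> \<delta> \<epsilon>. eqs_at \<tau> \<chi>) e"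
      unfolding \<open>e = (\<delta>, \<epsilon>)\<close>
      by (rule eq_consequence_cut[OF D(3) eq_consequence_premise[OF subsetD]])
  qed
qed

lemma not_algebraizable:
  fixes r :: "'w \<Rightarrow> 'w \<Rightarrow> nat" and w w' :: 'w
  assumes valid: "\<And>a \<phi>. a \<in> X \<Longrightarrow> \<phi> \<in> instances a \<Longrightarrow> valid r \<phi>"
    and "w \<noteq> w'"
  shows "\<not> algebraizable TYPE('a) (LV_ext X)"
proof
  assume "algebraizable TYPE('a) (LV_ext X)"
  then obtain K :: "'a alg set" and \<tau> \<Delta>
    where sem: "equivalent_algebraic_semantics (LV_ext X) K \<tau> \<Delta>"
    unfolding algebraizable_def by blast
  \<comment> \<open>Every variable is true at \<open>w\<close> and false at \<open>w'\<close>. The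
    aim is to carry \<open>Var 0\<close> over to \<open>w'\<close> through
    \<open>\<Delta>(\<tau>(Var 0))\<close>.\<close>
  let ?ev = "eval (complex_alg r) (\<lambda>_. {w})"
  have sound: "u \<in> ?ev \<phi>" if "LV_ext X \<Gamma> \<phi>" "\<forall>\<psi>\<in>\<Gamma>. u \<in> ?ev \<psi>" for \<Gamma> \<phi> u
    by (rule soundness[OF that(1) valid that(2)])
  let ?\<theta> = "\<^bold>\<box> (Var 0 \<^bold>\<leftrightarrow> Var 1)"
  have "w' \<in> ?ev \<chi>" if eq: "(\<delta>, \<epsilon>) \<in> eqs_at \<tau> (Var 0)" and \<chi>: "\<chi> \<in> fms_at \<Delta> \<delta> \<epsilon>" for \<delta> \<epsilon> \<chi>
  proof -
    have "w \<in> ?ev \<chi>" if "\<chi> \<in> fms_at \<Delta> \<delta> \<epsilon>" for \<chi>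
      by (rule sound[OF defining_equations(1)[OF sem eq that]]) simp
    moreover have "LV_ext X (fms_at \<Delta> \<delta> \<epsilon>) (subst (\<lambda>n. if n = 0 then \<delta> else \<epsilon>) ?\<theta>)"
    proof (rule equivalence_detachment[OF sem])
      have "LV_ext X {} (\<epsilon> \<^bold>\<rightarrow> \<epsilon>)"
        by (meson LV_ext.classical LV_ext.modus_ponens classical_axioms.intros(1,2))
      then have "LV_ext X {} (\<epsilon> \<^bold>\<leftrightarrow> \<epsilon>)"
        by (meson LV_ext.classical LV_ext.modus_ponens classical_axioms.intros(5))
      \<comment> \<open>Necessitation: a theorem is implied by its own negation, so monotonicity
        applied to L1 for that negation yields its box.\<close>
      then have "LV_ext X {} (\<^bold>\<not> (\<epsilon> \<^bold>\<leftrightarrow> \<epsilon>) \<^bold>\<rightarrow> (\<epsilon> \<^bold>\<leftrightarrow> \<epsilon>))"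
        by (meson LV_ext.classical LV_ext.modus_ponens classical_axioms.intros(1))
      then have "LV_ext X {} (\<^bold>\<box> (\<epsilon> \<^bold>\<leftrightarrow> \<epsilon>))"
        by (meson LV_ext.cond_mono LV_ext.modus_ponens LV_ext.conditional LV_axioms.L1)
      then show "LV_ext X {} (subst (\<lambda>_. \<epsilon>) ?\<theta>)" by simp
    qed
    ultimately have "w \<in> ?ev (\<^bold>\<box> (\<delta> \<^bold>\<leftrightarrow> \<epsilon>))"
      using sound by (simp del: eval.simps)
    then have "?ev (\<delta> \<^bold>\<leftrightarrow> \<epsilon>) = UNIV"
      unfolding eval_Box by blast
    then have ev: "?ev \<delta> = ?ev \<epsilon>" by auto
    \<comment> \<open>As \<open>\<delta>\<close> and \<open>\<epsilon>\<close> agree at all worlds,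
      \<open>\<chi> = \<xi>(\<delta>, \<epsilon>)\<close> has the value of the theorem
      \<open>\<xi>(\<delta>, \<delta>)\<close>, which holds at \<open>w'\<close> too.\<close>
    from \<chi> obtain \<xi> where "\<xi> \<in> \<Delta>" and \<xi>: "\<chi> = subst (\<lambda>n. if n = 0 then \<delta> else \<epsilon>) \<xi>"
      by (auto simp: fms_at_def)
    then have "subst (\<lambda>_. \<delta>) \<xi> \<in> fms_at \<Delta> \<delta> \<delta>"
      by (simp add: fms_at_def)
    from sound[OF equivalence_refl[OF sem this]] have "w' \<in> ?ev (subst (\<lambda>_. \<delta>) \<xi>)" by simp
    moreover have "?ev (if n = 0 then \<delta> else \<epsilon>) = ?ev \<delta>" for n :: nat
      using ev by simp
    ultimately show ?thesis unfolding \<xi> eval_subst by simp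
  qed
  then have "w' \<in> ?ev (Var 0)"
    by (intro sound[OF defining_equations(2)[OF sem]]) blast
  then show False using \<open>w \<noteq> w'\<close> by simp
qed


section \<open>Maximal consistent theories\<close>

text \<open>The rule \<open>cond_mono\<close> is no obstacle: its conclusion is a theorem and does
  not depend on \<open>\<phi>\<close>.\<close>

lemma deduction: "LV_ext X (insert \<phi> \<Gamma>) \<psi> \<Longrightarrow> LV_ext X \<Gamma> (\<phi> \<^bold>\<rightarrow> \<psi>)"
proof (induction "insert \<phi> \<Gamma>" \<psi> rule: LV_ext.induct)
  case (premise \<psi>)
  then show ?case
    by (metis LV_ext.classical LV_ext.modus_ponens LV_ext.premise classical_axioms.intros(1,2) insertE)
next
  case (modus_ponens \<psi> \<chi>)
  then show ?case
    by (meson LV_ext.classical LV_ext.modus_ponens classical_axioms.intros(2))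
qed (meson LV_ext.intros classical_axioms.intros(1))+

definition maximal_theory :: "lewis_axiom set \<Rightarrow> fm set \<Rightarrow> bool" where
  "maximal_theory X M \<longleftrightarrow>
     (\<forall>\<phi>. LV_ext X M \<phi> \<longrightarrow> \<phi> \<in> M) \<and> \<^bold>0 \<notin> M \<and> (\<forall>\<phi>. \<phi> \<in> M \<or> \<^bold>\<not> \<phi> \<in> M)"

text \<open>Zorn's lemma on the extensions of \<open>\<Gamma>\<close> that do not derive
  \<open>\<phi>\<close>; finitarity keeps unions of chains among them.\<close>

lemma lindenbaum:
  assumes "\<not> LV_ext X \<Gamma> \<phi>"
  obtains M where "maximal_theory X M" and "\<Gamma> \<subseteq> M" and "\<phi> \<notin> M"
proof -
  define T where "T = {\<Gamma>'. \<Gamma> \<subseteq> \<Gamma>' \<and> \<not> LV_ext X \<Gamma>' \<phi>}"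
  have chain: "\<Union>C \<in> T" if C: "C \<noteq> {}" "subset.chain T C" for C
  proof -
    have "\<not> LV_ext X (\<Union>C) \<phi>"
    proof
      assume "LV_ext X (\<Union>C) \<phi>"
      then obtain F where "finite F" "F \<subseteq> \<Union>C" "LV_ext X F \<phi>"
        using LV_ext_finitary[of X] unfolding finitary_def by blast
      moreover obtain B where "B \<in> C" "F \<subseteq> B"
        using finite_subset_Union_chain[OF calculation(1,2) C] by blast
      moreover from \<open>B \<in> C\<close> have "\<not> LV_ext X B \<phi>"
        using C(2) unfolding subset_chain_def T_def by blast
      ultimately show False by (blast dest: LV_ext_mono)
    qed
    then show ?thesis using C unfolding subset_chain_def T_def by blast
  qed
  have "T \<noteq> {}" using assms by (auto simp: T_def)
  from subset_Zorn_nonempty[OF this chain]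
  obtain M where "M \<in> T" and max: "\<And>\<Gamma>'. \<Gamma>' \<in> T \<Longrightarrow> M \<subseteq> \<Gamma>' \<Longrightarrow> \<Gamma>' = M"
    by blast
  then have M: "\<Gamma> \<subseteq> M" "\<not> LV_ext X M \<phi>" by (simp_all add: T_def)
  have ins: "LV_ext X M (\<psi> \<^bold>\<rightarrow> \<phi>)" if "\<psi> \<notin> M" for \<psi>
  proof (rule deduction, rule ccontr)
    assume "\<not> LV_ext X (insert \<psi> M) \<phi>"
    then have "insert \<psi> M = M"
      using M(1) by (intro max) (auto simp: T_def)
    then show False using that by blast
  qed
  have "\<psi> \<in> M" if "LV_ext X M \<psi>" for \<psi>
    using ins LV_ext.modus_ponens that M(2) by blast
  moreover have "\<^bold>0 \<notin> M"
    using M(2) by (blast intro: LV_ext.intros classical_axioms.intros)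
  moreover have "\<psi> \<in> M \<or> \<^bold>\<not> \<psi> \<in> M" for \<psi>
  proof (rule ccontr)
    assume "\<not> (\<psi> \<in> M \<or> \<^bold>\<not> \<psi> \<in> M)"
    then have 1: "LV_ext X M (\<psi> \<^bold>\<rightarrow> \<phi>)" and 2: "LV_ext X M (\<^bold>\<not> \<psi> \<^bold>\<rightarrow> \<phi>)"
      using ins by blast+
    \<comment> \<open>With the negation of \<open>\<phi>\<close> added, \<open>\<psi>\<close> is
      refuted; then the negation of \<open>\<psi>\<close> yields \<open>\<phi>\<close>, a
      contradiction.\<close>
    have "LV_ext X (insert \<psi> (insert (\<^bold>\<not> \<phi>) M)) \<^bold>0"
      using LV_ext_mono[OF 1, of "insert \<psi> (insert (\<^bold>\<not> \<phi>) M)"]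
      by (meson LV_ext.modus_ponens LV_ext.premise insertCI subset_insertI2 subset_refl)
    then have "LV_ext X (insert (\<^bold>\<not> \<phi>) M) (\<^bold>\<not> \<psi>)" by (rule deduction)
    then have "LV_ext X (insert (\<^bold>\<not> \<phi>) M) \<^bold>0"
      using LV_ext_mono[OF 2, of "insert (\<^bold>\<not> \<phi>) M"]
      by (meson LV_ext.modus_ponens LV_ext.premise insertCI subset_insertI)
    then have "LV_ext X M (\<^bold>\<not> \<^bold>\<not> \<phi>)" by (rule deduction)
    then show False
      using M(2) LV_ext.modus_ponens LV_ext.classical classical_axioms.intros(11) by blast
  qed
  moreover have "\<phi> \<notin> M" using M(2) LV_ext.premise by blast
  ultimately show thesis using that M(1) unfolding maximal_theory_def by blast
qed

context
  fixes X M
  assumes max: "maximal_theory X M"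
begin

lemma maximal_theory_mp: "\<phi> \<^bold>\<rightarrow> \<psi> \<in> M \<Longrightarrow> \<phi> \<in> M \<Longrightarrow> \<psi> \<in> M"
  using max unfolding maximal_theory_def by (meson LV_ext.modus_ponens LV_ext.premise)

lemma maximal_theory_theorem: "LV_ext X {} \<phi> \<Longrightarrow> \<phi> \<in> M"
  using max LV_ext_mono[of X "{}" \<phi> M] unfolding maximal_theory_def by blast

lemma maximal_theory_axiom: "\<phi> \<in> classical_axioms \<Longrightarrow> \<phi> \<in> M"
  by (blast intro: maximal_theory_theorem LV_ext.classical)

lemma maximal_theory_Falsum: "\<^bold>0 \<notin> M"
  using max unfolding maximal_theory_def by blast

lemma maximal_theory_Verum: "\<^bold>1 \<in> M"
  by (blast intro: maximal_theory_axiom classical_axioms.intros)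

lemma maximal_theory_Imp: "\<phi> \<^bold>\<rightarrow> \<psi> \<in> M \<longleftrightarrow> (\<phi> \<in> M \<longrightarrow> \<psi> \<in> M)"
proof -
  have "\<phi> \<^bold>\<rightarrow> \<psi> \<in> M" if "\<phi> \<notin> M"
  proof -
    have "\<^bold>\<not> \<phi> \<in> M" using that max unfolding maximal_theory_def by blast
    moreover have "(\<phi> \<^bold>\<rightarrow> \<^bold>0 \<^bold>\<rightarrow> \<psi>) \<^bold>\<rightarrow> (\<phi> \<^bold>\<rightarrow> \<^bold>0) \<^bold>\<rightarrow> \<phi> \<^bold>\<rightarrow> \<psi> \<in> M"
      and "(\<^bold>0 \<^bold>\<rightarrow> \<psi>) \<^bold>\<rightarrow> \<phi> \<^bold>\<rightarrow> \<^bold>0 \<^bold>\<rightarrow> \<psi> \<in> M" and "\<^bold>0 \<^bold>\<rightarrow> \<psi> \<in> M"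
      by (blast intro: maximal_theory_axiom classical_axioms.intros)+
    ultimately show ?thesis using maximal_theory_mp by blast
  qed
  moreover have "\<psi> \<^bold>\<rightarrow> \<phi> \<^bold>\<rightarrow> \<psi> \<in> M"
    by (blast intro: maximal_theory_axiom classical_axioms.intros)
  ultimately show ?thesis using maximal_theory_mp by blast
qed

lemma maximal_theory_Conj: "\<phi> \<^bold>\<and> \<psi> \<in> M \<longleftrightarrow> \<phi> \<in> M \<and> \<psi> \<in> M"
proof -
  have "\<phi> \<^bold>\<and> \<psi> \<^bold>\<rightarrow> \<phi> \<in> M" "\<phi> \<^bold>\<and> \<psi> \<^bold>\<rightarrow> \<psi> \<in> M" "\<phi> \<^bold>\<rightarrow> \<psi> \<^bold>\<rightarrow> \<phi> \<^bold>\<and> \<psi> \<in> M"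
    by (blast intro: maximal_theory_axiom classical_axioms.intros)+
  then show ?thesis using maximal_theory_mp by blast
qed

lemma maximal_theory_Disj: "\<phi> \<^bold>\<or> \<psi> \<in> M \<longleftrightarrow> \<phi> \<in> M \<or> \<psi> \<in> M"
proof -
  have "\<phi> \<^bold>\<rightarrow> \<phi> \<^bold>\<or> \<psi> \<in> M" "\<psi> \<^bold>\<rightarrow> \<phi> \<^bold>\<or> \<psi> \<in> M"
    "(\<phi> \<^bold>\<rightarrow> \<^bold>0) \<^bold>\<rightarrow> (\<psi> \<^bold>\<rightarrow> \<^bold>0) \<^bold>\<rightarrow> \<phi> \<^bold>\<or> \<psi> \<^bold>\<rightarrow> \<^bold>0 \<in> M"
    by (blast intro: maximal_theory_axiom classical_axioms.intros)+
  then show ?thesis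
    using maximal_theory_Imp maximal_theory_Falsum by metis
qed

lemmas maximal_theory_simps =
  maximal_theory_Falsum maximal_theory_Verum maximal_theory_Imp maximal_theory_Conj
  maximal_theory_Disj

end

text \<open>Replaces Hilbert-style derivations by computing membership with
  \<open>maximal_theory_simps\<close>.\<close>

lemma theorem_if_in_maximal:
  "(\<And>M. maximal_theory X M \<Longrightarrow> \<phi> \<in> M) \<Longrightarrow> LV_ext X {} \<phi>"
  using lindenbaum by metis

lemma maximal_theory_Cond_mono:
  assumes "maximal_theory X M" and "\<gamma> \<box>\<rightarrow> \<phi> \<in> M"
    and "\<And>N. maximal_theory X N \<Longrightarrow> \<phi> \<in> N \<Longrightarrow> \<psi> \<in> N"
  shows "\<gamma> \<box>\<rightarrow> \<psi> \<in> M"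
proof -
  have "LV_ext X {} (\<phi> \<^bold>\<rightarrow> \<psi>)"
    using assms(3) by (intro theorem_if_in_maximal) (simp add: maximal_theory_simps)
  then show ?thesis
    using assms(1,2) LV_ext.cond_mono maximal_theory_theorem maximal_theory_mp by meson
qed


section \<open>Collapse of the conditional\<close>

text \<open>Centering is stated through membership so that C, and W with S, can be treated
  alike.\<close>

locale collapsing =
  fixes X
  assumes A: "Ax_A \<in> X"
    and weak_centering: "maximal_theory X M \<Longrightarrow> \<phi> \<box>\<rightarrow> \<psi> \<in> M \<Longrightarrow> \<phi> \<in> M \<Longrightarrow> \<psi> \<in> M"
    and centering: "maximal_theory X M \<Longrightarrow> \<phi> \<in> M \<Longrightarrow> \<psi> \<in> M \<Longrightarrow> \<phi> \<box>\<rightarrow> \<psi> \<in> M"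
begin

text \<open>The antecedent \<open>\<phi> \<or> \<not> \<phi>\<close> lies in \<open>M\<close>, so by
  centering a conditional from it says no more than its consequent.\<close>

lemma at_least_as_possible:
  assumes "maximal_theory X M"
  shows "\<phi> \<^bold>\<preceq> \<^bold>\<not> \<phi> \<in> M \<longleftrightarrow> \<phi> \<in> M"
proof -
  note [simp] = maximal_theory_simps[OF assms]
  have "(\<phi> \<^bold>\<or> \<^bold>\<not> \<phi>) \<box>\<rightarrow> \<psi> \<in> M \<longleftrightarrow> \<psi> \<in> M" for \<psi>
    using weak_centering[OF assms, of "\<phi> \<^bold>\<or> \<^bold>\<not> \<phi>" \<psi>] centering[OF assms, of "\<phi> \<^bold>\<or> \<^bold>\<not> \<phi>" \<psi>] by auto
  then show ?thesis by auto
qed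

text \<open>
  Where \<open>\<phi>\<close> fails, \<open>\<not> \<phi>\<close> is more possible than \<open>\<phi>\<close>. By absoluteness this holds at every accessible
  world, while by centering it fails wherever \<open>\<phi>\<close> holds. So no accessible world satisfies \<open>\<phi>\<close>.
\<close>

lemma vacuous:
  assumes M: "maximal_theory X M" and "\<phi> \<notin> M"
  shows "\<phi> \<box>\<rightarrow> \<psi> \<in> M"
proof -
  \<comment> \<open>\<open>q\<close> is equivalent to the negation of \<open>\<phi>\<close> in every
    maximal theory, but has the form that absoluteness can box.\<close>
  define q where "q = \<^bold>\<not> \<phi> \<^bold>\<prec> \<phi>"
  have q: "q \<in> N \<longleftrightarrow> \<phi> \<notin> N" if "maximal_theory X N" for N
    using at_least_as_possible[OF that, of \<phi>] by (simp add: q_def maximal_theory_simps[OF that])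
  have "((\<^bold>\<not> \<phi> \<^bold>\<preceq> \<phi>) \<^bold>\<rightarrow> \<^bold>\<box> (\<^bold>\<not> \<phi> \<^bold>\<preceq> \<phi>)) \<^bold>\<and> (q \<^bold>\<rightarrow> \<^bold>\<box> q) \<in> M"
    unfolding q_def
    by (intro maximal_theory_theorem[OF M] LV_ext.extension[OF A]) auto
  then have "\<^bold>\<not> q \<box>\<rightarrow> q \<in> M"
    by (simp add: q[OF M] \<open>\<phi> \<notin> M\<close> maximal_theory_simps[OF M])
  moreover have L1: "\<gamma> \<box>\<rightarrow> \<gamma> \<in> M" for \<gamma>
    by (blast intro: maximal_theory_theorem[OF M] LV_ext.conditional LV_axioms.L1)
  have "\<^bold>\<not> q \<box>\<rightarrow> \<phi> \<in> M"
    by (rule maximal_theory_Cond_mono[OF M L1]) (simp add: q maximal_theory_simps)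
  moreover have "\<phi> \<box>\<rightarrow> \<^bold>\<not> q \<in> M"
    by (rule maximal_theory_Cond_mono[OF M L1]) (simp add: q maximal_theory_simps)
  \<comment> \<open>L2 trades the antecedent \<open>\<not> q\<close> of the boxed formula for the
    equivalent \<open>\<phi>\<close>.\<close>
  moreover have "((\<^bold>\<not> q \<box>\<rightarrow> \<phi>) \<^bold>\<and> (\<phi> \<box>\<rightarrow> \<^bold>\<not> q)) \<^bold>\<rightarrow> ((\<^bold>\<not> q \<box>\<rightarrow> q) \<^bold>\<leftrightarrow> (\<phi> \<box>\<rightarrow> q)) \<in> M"
    by (blast intro: maximal_theory_theorem[OF M] LV_ext.conditional LV_axioms.L2)
  ultimately have "\<phi> \<box>\<rightarrow> q \<in> M"
    by (simp add: maximal_theory_simps[OF M])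
  moreover have "(\<phi> \<box>\<rightarrow> (\<phi> \<^bold>\<and> q)) \<^bold>\<leftrightarrow> ((\<phi> \<box>\<rightarrow> \<phi>) \<^bold>\<and> (\<phi> \<box>\<rightarrow> q)) \<in> M"
    by (blast intro: maximal_theory_theorem[OF M] LV_ext.conditional LV_axioms.L4)
  \<comment> \<open>No maximal theory contains both \<open>\<phi>\<close> and \<open>q\<close>, so
    monotonicity reaches any consequent from here.\<close>
  ultimately have "\<phi> \<box>\<rightarrow> (\<phi> \<^bold>\<and> q) \<in> M"
    by (simp add: L1 maximal_theory_simps[OF M])
  then show ?thesis
    by (rule maximal_theory_Cond_mono[OF M]) (simp add: q maximal_theory_simps)
qed

lemma collapse: "maximal_theory X M \<Longrightarrow> \<phi> \<box>\<rightarrow> \<psi> \<in> M \<longleftrightarrow> (\<phi> \<in> M \<longrightarrow> \<psi> \<in> M)"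
  using weak_centering centering vacuous by blast

end


section \<open>Completeness for the two-element algebra\<close>

text \<open>The two-element algebra, presented as a complex algebra so that \<open>soundness\<close>
  applies to it.\<close>

definition one_point :: "unit set alg" where
  "one_point = complex_alg (\<lambda>_ _. 0)"

lemma eval_one_point [simp]:
  "() \<notin> eval one_point v \<^bold>0"
  "() \<in> eval one_point v \<^bold>1"
  "() \<in> eval one_point v (\<phi> \<^bold>\<and> \<psi>) \<longleftrightarrow> () \<in> eval one_point v \<phi> \<and> () \<in> eval one_point v \<psi>"
  "() \<in> eval one_point v (\<phi> \<^bold>\<or> \<psi>) \<longleftrightarrow> () \<in> eval one_point v \<phi> \<or> () \<in> eval one_point v \<psi>"
  "() \<in> eval one_point v (\<phi> \<^bold>\<rightarrow> \<psi>) \<longleftrightarrow> (() \<in> eval one_point v \<phi> \<longrightarrow> () \<in> eval one_point v \<psi>)"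
  "() \<in> eval one_point v (\<phi> \<box>\<rightarrow> \<psi>) \<longleftrightarrow> (() \<in> eval one_point v \<phi> \<longrightarrow> () \<in> eval one_point v \<psi>)"
  by (auto simp: one_point_def minimal_def)

lemma (in collapsing) completeness:
  "LV_ext X \<Gamma> \<phi> \<longleftrightarrow> (\<forall>v. (\<forall>\<psi>\<in>\<Gamma>. () \<in> eval one_point v \<psi>) \<longrightarrow> () \<in> eval one_point v \<phi>)"
    (is "_ \<longleftrightarrow> ?entails")
proof
  \<comment> \<open>A single world meets all the frame conditions, so all seven axioms hold
    there.\<close>
  have "valid (\<lambda>_ _ :: unit. 0) \<phi>" if "\<phi> \<in> instances a" for a \<phi>
    using that
    by (cases a)
      (simp_all del: instances.simps
        add: valid_W valid_C valid_N valid_T valid_S valid_U valid_A inj_def)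
  then show "LV_ext X \<Gamma> \<phi> \<Longrightarrow> ?entails"
    unfolding one_point_def by (blast intro: soundness)
next
  assume entails: ?entails
  show "LV_ext X \<Gamma> \<phi>"
  proof (rule ccontr)
    assume "\<not> LV_ext X \<Gamma> \<phi>"
    then obtain M where M: "maximal_theory X M" "\<Gamma> \<subseteq> M" "\<phi> \<notin> M"
      by (rule lindenbaum)
    \<comment> \<open>Truth lemma: \<open>M\<close> itself is a valuation, and
      \<open>collapse\<close> settles the conditional.\<close>
    have "() \<in> eval one_point (\<lambda>n. {_. Var n \<in> M}) \<psi> \<longleftrightarrow> \<psi> \<in> M" for \<psi>
      by (induction \<psi>)
        (simp_all del: eval.simps(2-7) add: maximal_theory_simps[OF M(1)] collapse[OF M(1)])
    then show False using entails M(2,3) by blast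
  qed
qed

text \<open>A copy of \<open>one_point\<close> inside \<open>'a\<close>, the carrier type that
  \<open>algebraizable\<close> prescribes.\<close>

definition two_element :: "'a \<Rightarrow> 'a \<Rightarrow> 'a alg" where
  "two_element a b = \<lparr>univ = {a, b}, zero_op = a, one_op = b,
     meet_op = (\<lambda>x y. if x = b \<and> y = b then b else a),
     join_op = (\<lambda>x y. if x = b \<or> y = b then b else a),
     imp_op = (\<lambda>x y. if x = b \<longrightarrow> y = b then b else a),
     cond_op = (\<lambda>x y. if x = b \<longrightarrow> y = b then b else a)\<rparr>"

lemma two_element_simps [simp]:
  "univ (two_element a b) = {a, b}"
  "zero_op (two_element a b) = a"
  "one_op (two_element a b) = b"
  "meet_op (two_element a b) x y = (if x = b \<and> y = b then b else a)"
  "join_op (two_element a b) x y = (if x = b \<or> y = b then b else a)"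
  "imp_op (two_element a b) x y = (if x = b \<longrightarrow> y = b then b else a)"
  "cond_op (two_element a b) x y = (if x = b \<longrightarrow> y = b then b else a)"
  by (simp_all add: two_element_def)

lemma eval_two_element:
  assumes "a \<noteq> b" and "range h \<subseteq> {a, b}"
  shows "eval (two_element a b) h \<phi> =
    (if () \<in> eval one_point (\<lambda>n. {_. h n = b}) \<phi> then b else a)"
proof (induction \<phi>)
  case (Var n)
  then show ?case using assms by auto
qed (use assms(1) in
  \<open>simp_all del: eval.simps(2-7) add: eval.simps(2-7)[of "two_element a b"]\<close>)

text \<open>The usual witnesses for classical logic. Once \<open>cons\<close> and
  \<open>completeness\<close> express both consequence relations over \<open>one_point\<close>, only
  truth tables remain.\<close>

lemma (in collapsing) algebraizable_two_element:
  fixes a b :: 'a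
  assumes "a \<noteq> b"
  shows "equivalent_algebraic_semantics (LV_ext X) {two_element a b}
    {(Var 0, \<^bold>1)} {Var 0 \<^bold>\<rightarrow> Var 1, Var 1 \<^bold>\<rightarrow> Var 0}"
proof -
  have cons: "eq_consequence {two_element a b} E e \<longleftrightarrow> (\<forall>v.
      (\<forall>(\<alpha>, \<beta>)\<in>E. () \<in> eval one_point v \<alpha> \<longleftrightarrow> () \<in> eval one_point v \<beta>) \<longrightarrow>
      (() \<in> eval one_point v (fst e) \<longleftrightarrow> () \<in> eval one_point v (snd e)))"
    (is "_ \<longleftrightarrow> (\<forall>v. ?P v)") for E e
  proof -
    have "eval (two_element a b) h \<alpha> = eval (two_element a b) h \<beta> \<longleftrightarrow>
        (() \<in> eval one_point (\<lambda>n. {_. h n = b}) \<alpha> \<longleftrightarrow> () \<in> eval one_point (\<lambda>n. {_. h n = b}) \<beta>)"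
      if "range h \<subseteq> {a, b}" for h \<alpha> \<beta>
      using \<open>a \<noteq> b\<close> by (simp add: eval_two_element[OF \<open>a \<noteq> b\<close> that])
    then have "eq_consequence {two_element a b} E e \<longleftrightarrow>
        (\<forall>h. range h \<subseteq> {a, b} \<longrightarrow> ?P (\<lambda>n. {_. h n = b}))"
      by (simp add: eq_consequence_def split_beta cong: imp_cong)
    also have "\<dots> \<longleftrightarrow> (\<forall>v. ?P v)"
    proof (intro iffI allI)
      fix v :: "nat \<Rightarrow> unit set" assume *: "\<forall>h. range h \<subseteq> {a, b} \<longrightarrow> ?P (\<lambda>n. {_. h n = b})"
      \<comment> \<open>Every valuation in \<open>one_point\<close> comes from an assignment into
        \<open>{a, b}\<close>.\<close>
      have "v = (\<lambda>n. {_. (if () \<in> v n then b else a) = b})"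
        using \<open>a \<noteq> b\<close> by (auto simp: fun_eq_iff set_eq_iff)
      then show "?P v" using *[rule_format, of "\<lambda>n. if () \<in> v n then b else a"] by auto
    qed blast
    finally show ?thesis .
  qed
  have eqs: "eqs_at {(Var 0, \<^bold>1)} \<phi> = {(\<phi>, \<^bold>1)}" for \<phi>
    by (simp add: eqs_at_def)
  have fms: "fms_at {Var 0 \<^bold>\<rightarrow> Var 1, Var 1 \<^bold>\<rightarrow> Var 0} \<phi> \<psi> = {\<phi> \<^bold>\<rightarrow> \<psi>, \<psi> \<^bold>\<rightarrow> \<phi>}" for \<phi> \<psi>
    by (simp add: fms_at_def)
  have "is_algebra (two_element a b)"
    by (simp add: is_algebra_def)
  then show ?thesis
    unfolding equivalent_algebraic_semantics_def cons eqs fms completeness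
    by (auto simp del: eval.simps)
qed

section \<open>Classification of the sets of axioms\<close>

text \<open>C contains both centering conditions. Otherwise, when \<open>\<phi>\<close> and
  \<open>\<psi>\<close> hold, S leaves two conditionals and W excludes the one with consequent
  \<open>\<not> \<psi>\<close>.\<close>

lemma collapsing_if:
  assumes "Ax_A \<in> X" and "Ax_C \<in> X \<or> Ax_W \<in> X \<and> Ax_S \<in> X"
  shows "collapsing X"
proof
  fix M \<phi> \<psi>
  assume M: "maximal_theory X M"
  have ax: "\<chi> \<in> M" if "a \<in> X" "\<chi> \<in> instances a" for a \<chi>
    using that by (blast intro: maximal_theory_theorem[OF M] LV_ext.extension)
  have W: "(\<phi> \<box>\<rightarrow> \<psi>) \<^bold>\<rightarrow> (\<phi> \<^bold>\<rightarrow> \<psi>) \<in> M" for \<phi> \<psi>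
  proof (cases "Ax_C \<in> X")
    case True
    then have "((\<phi> \<box>\<rightarrow> \<psi>) \<^bold>\<rightarrow> (\<phi> \<^bold>\<rightarrow> \<psi>)) \<^bold>\<and> ((\<phi> \<^bold>\<and> \<psi>) \<^bold>\<rightarrow> (\<phi> \<box>\<rightarrow> \<psi>)) \<in> M"
      by (rule ax) auto
    then show ?thesis by (simp add: maximal_theory_simps[OF M])
  next
    case False
    then show ?thesis using assms(2) by (intro ax[of Ax_W]) auto
  qed
  then show "\<phi> \<box>\<rightarrow> \<psi> \<in> M \<Longrightarrow> \<phi> \<in> M \<Longrightarrow> \<psi> \<in> M"
    using W[of \<phi> \<psi>] by (simp add: maximal_theory_simps[OF M])
  assume "\<phi> \<in> M" "\<psi> \<in> M"
  show "\<phi> \<box>\<rightarrow> \<psi> \<in> M"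
  proof (cases "Ax_C \<in> X")
    case True
    then have "((\<phi> \<box>\<rightarrow> \<psi>) \<^bold>\<rightarrow> (\<phi> \<^bold>\<rightarrow> \<psi>)) \<^bold>\<and> ((\<phi> \<^bold>\<and> \<psi>) \<^bold>\<rightarrow> (\<phi> \<box>\<rightarrow> \<psi>)) \<in> M"
      by (rule ax) auto
    then show ?thesis using \<open>\<phi> \<in> M\<close> \<open>\<psi> \<in> M\<close> by (simp add: maximal_theory_simps[OF M])
  next
    case False
    then have "(\<phi> \<box>\<rightarrow> \<psi>) \<^bold>\<or> (\<phi> \<box>\<rightarrow> \<^bold>\<not> \<psi>) \<in> M"
      using assms(2) by (intro ax[of Ax_S]) auto
    then show ?thesis
      using W[of \<phi> "\<^bold>\<not> \<psi>"] \<open>\<phi> \<in> M\<close> \<open>\<psi> \<in> M\<close>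
      by (auto simp: maximal_theory_simps[OF M])
  qed
qed (fact assms(1))

lemma not_algebraizable_if:
  assumes "\<not> (Ax_A \<in> X \<and> (Ax_C \<in> X \<or> Ax_W \<in> X \<and> Ax_S \<in> X))"
  shows "\<not> algebraizable TYPE('a) (LV_ext X)"
proof -
  note intros = valid_W valid_C valid_N valid_T valid_S valid_U valid_A
  consider "Ax_A \<notin> X" | "Ax_C \<notin> X" "Ax_W \<notin> X" | "Ax_C \<notin> X" "Ax_S \<notin> X"
    using assms by blast
  then show ?thesis
  proof cases
    case 1
    \<comment> \<open>Each world is strictly closest to itself and there are no ties: everything but
      A holds.\<close>
    have "valid (\<lambda>w u :: bool. of_bool (u \<noteq> w)) \<phi>" if "a \<in> X" "\<phi> \<in> instances a" for a \<phi>
      using that 1 by (cases a) (simp_all del: instances.simps add: intros inj_def)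
    then show ?thesis by (rule not_algebraizable[of X _ True False]) simp_all
  next
    case 2
    \<comment> \<open>A shared ranking without ties gives S and A; \<open>False\<close> is closest
      even from \<open>True\<close>, which violates W.\<close>
    have "valid (\<lambda>w u :: bool. of_bool u) \<phi>" if "a \<in> X" "\<phi> \<in> instances a" for a \<phi>
      using that 2 by (cases a) (simp_all del: instances.simps add: intros inj_def)
    then show ?thesis by (rule not_algebraizable[of X _ True False]) simp_all
  next
    case 3
    \<comment> \<open>All worlds tie: W and A hold, and the tie violates C and S.\<close>
    have "valid (\<lambda>w u :: bool. 0) \<phi>" if "a \<in> X" "\<phi> \<in> instances a" for a \<phi>
      using that 3 by (cases a) (simp_all del: instances.simps add: intros)
    then show ?thesis by (rule not_algebraizable[of X _ True False]) simp_all
  qed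
qed

theorem theorem4p24:
  fixes X :: "lewis_axiom set"
  assumes "infinite (UNIV :: 'a set)"
  shows "algebraizable TYPE('a) (LV_ext X) \<longleftrightarrow> LV_ext X = LVCA"
proof -
  obtain a b :: 'a where "a \<noteq> b"
    using assms by (metis (full_types) UNIV_eq_I finite.simps insertI1)
  then have alg: "algebraizable TYPE('a) (LV_ext Y)" if "collapsing Y" for Y
    unfolding algebraizable_def
    by (intro exI) (rule collapsing.algebraizable_two_element[OF that \<open>a \<noteq> b\<close>])
  have LVCA: "collapsing {Ax_C, Ax_A}"
    by (rule collapsing_if) auto
  show ?thesis
  proof (cases "Ax_A \<in> X \<and> (Ax_C \<in> X \<or> Ax_W \<in> X \<and> Ax_S \<in> X)")
    case True
    then have "collapsing X" by (blast intro: collapsing_if)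
    \<comment> \<open>By completeness for the same algebra, all collapsing extensions have one
      consequence relation.\<close>
    then have "LV_ext X = LVCA"
      by (intro ext) (simp only: collapsing.completeness[OF LVCA] collapsing.completeness)
    then show ?thesis using alg[OF LVCA] by simp
  next
    case False
    \<comment> \<open>\<open>LVCA\<close> is algebraizable and \<open>LV_ext X\<close> is not, so
      they differ.\<close>
    then show ?thesis using not_algebraizable_if alg[OF LVCA] by metis
  qed
qed

end
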